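(* Let $n\ge 1$ and let $\eta$ be an $\ell$-homomorphism of $\mathcal A_n$ onto $\mathcal A_n$. Then $\eta$ is one-one.
   Context: All $\ell$-groups (lattice-ordered groups) are abelian, and an $\ell$-homomorphism is a map preserving the group and lattice operations. $\mathcal A_n$ denotes the free abelian $\ell$-group on $n$ free generators; concretely, $\mathcal A_n$ is the $\ell$-group, under pointwise operations $0,+,-,\vee=\max,\wedge=\min$, of all continuous functions $f\colon\mathbb R^n\to\mathbb R$ for which there are finitely many homogeneous linear functions $l_1,\ldots,l_r$ with integer coefficients such that for each $x\in\mathbb R^n$ there is $j$ with $f(x)=l_j(x)$. Its free generators are the coordinate functions $\pi_1,\ldots,\pi_n$. *)

theory Defs
  imports "HOL-Analysis.Analysis" "HOL-Library.Function_Algebras"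
begin

text \<open>
  The free abelian lattice-ordered group on \<open>n\<close> generators, in its concrete representation as a
  set of functions on \<open>\<real>\<^sup>n\<close>. The number \<open>n \<ge> 1\<close> is \<open>CARD('n)\<close> for an arbitrary finite index type
  \<open>'n\<close>. The pointwise operations \<open>0\<close>, \<open>+\<close>, unary \<open>-\<close> on functions come from
  \<^theory>\<open>HOL-Library.Function_Algebras\<close>, and \<open>sup\<close>, \<open>inf\<close> from the pointwise lattice
  structure on functions (with \<open>sup = max\<close> and \<open>inf = min\<close> on the reals).
\<close>

definition integer_linear :: "(real ^ 'n \<Rightarrow> real) \<Rightarrow> bool" where
  "integer_linear l \<longleftrightarrow> (\<exists>c :: 'n \<Rightarrow> int. \<forall>x. l x = (\<Sum>i\<in>UNIV. of_int (c i) * x $ i))"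

definition free_lgroup :: "(real ^ 'n \<Rightarrow> real) set" where
  "free_lgroup = {f. continuous_on UNIV f \<and>
     (\<exists>L. finite L \<and> (\<forall>l\<in>L. integer_linear l) \<and> (\<forall>x. \<exists>l\<in>L. f x = l x))}"

text \<open>
  Homomorphisms between sets \<open>A\<close>, \<open>B\<close> that are closed under the operations of the ambient
  types; the values of \<open>h\<close> outside \<open>A\<close> are irrelevant.
\<close>

definition lgroup_hom ::
  "'a::{ab_group_add, lattice} set \<Rightarrow> 'b::{ab_group_add, lattice} set \<Rightarrow> ('a \<Rightarrow> 'b) \<Rightarrow> bool" where
  "lgroup_hom A B h \<longleftrightarrow>
     h \<in> A \<rightarrow> B \<and>
     h 0 = 0 \<and>
     (\<forall>f\<in>A. h (- f) = - h f) \<and>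
     (\<forall>f\<in>A. \<forall>g\<in>A. h (f + g) = h f + h g) \<and>
     (\<forall>f\<in>A. \<forall>g\<in>A. h (sup f g) = sup (h f) (h g)) \<and>
     (\<forall>f\<in>A. \<forall>g\<in>A. h (inf f g) = inf (h f) (h g))"

lemma integer_linear_zero: "integer_linear (\<lambda>x. 0)"
  unfolding integer_linear_def by (rule exI[of _ "\<lambda>i. 0"]) simp

lemma integer_linear_uminus:
  assumes "integer_linear l" shows "integer_linear (- l)"
proof -
  obtain c where "\<forall>x. l x = (\<Sum>i\<in>UNIV. of_int (c i) * x $ i)"
    using assms unfolding integer_linear_def by blast
  then show ?thesis
    unfolding integer_linear_def by (intro exI[of _ "\<lambda>i. - c i"]) (simp add: sum_negf)
qed

lemma integer_linear_add:
  assumes "integer_linear l" "integer_linear m" shows "integer_linear (l + m)"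
proof -
  obtain c d where "\<forall>x. l x = (\<Sum>i\<in>UNIV. of_int (c i) * x $ i)"
    "\<forall>x. m x = (\<Sum>i\<in>UNIV. of_int (d i) * x $ i)"
    using assms unfolding integer_linear_def by blast
  then show ?thesis
    unfolding integer_linear_def
    by (intro exI[of _ "\<lambda>i. c i + d i"]) (simp add: sum.distrib algebra_simps)
qed

lemma free_lgroupI:
  assumes "continuous_on UNIV f" "finite L" "\<And>l. l \<in> L \<Longrightarrow> integer_linear l"
    "\<And>x. \<exists>l\<in>L. f x = l x"
  shows "f \<in> free_lgroup"
  using assms unfolding free_lgroup_def by blast

lemma free_lgroupE:
  assumes "f \<in> free_lgroup"
  obtains L where "continuous_on UNIV f" "finite L" "\<And>l. l \<in> L \<Longrightarrow> integer_linear l"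
    "\<And>x. \<exists>l\<in>L. f x = l x"
  using assms unfolding free_lgroup_def by blast

lemma coordinate_in_free_lgroup: "(\<lambda>x. x $ i) \<in> free_lgroup"
proof (rule free_lgroupI[where L = "{\<lambda>x. x $ i}"])
  have "x $ i = (\<Sum>j\<in>UNIV. of_int (if j = i then 1 else 0) * x $ j)" for x :: "real ^ 'a"
  proof -
    have "(\<Sum>j\<in>UNIV. of_int (if j = i then 1 else 0) * x $ j) = (\<Sum>j\<in>UNIV. if j = i then x $ j else 0)"
      by (rule sum.cong) auto
    then show ?thesis by simp
  qed
  then show "integer_linear l" if "l \<in> {\<lambda>x :: real ^ 'a. x $ i}" for l
    using that unfolding integer_linear_def
    by (intro exI[of _ "\<lambda>j. if j = i then 1 else 0"]) simp
qed (auto intro!: continuous_intros)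

lemma zero_in_free_lgroup: "0 \<in> free_lgroup"
  by (rule free_lgroupI[where L = "{\<lambda>x. 0}"])
    (auto simp: integer_linear_zero zero_fun_def)

lemma uminus_in_free_lgroup:
  assumes "f \<in> free_lgroup" shows "- f \<in> free_lgroup"
proof -
  obtain L where L: "continuous_on UNIV f" "finite L" "\<And>l. l \<in> L \<Longrightarrow> integer_linear l"
    "\<And>x. \<exists>l\<in>L. f x = l x"
    using assms by (rule free_lgroupE) blast
  show ?thesis
  proof (rule free_lgroupI[where L = "uminus ` L"])
    show "continuous_on UNIV (- f)"
      using L(1) unfolding fun_Compl_def by (rule continuous_on_minus)
  qed (use L integer_linear_uminus in auto)
qed

lemma add_in_free_lgroup:
  assumes "f \<in> free_lgroup" "g \<in> free_lgroup" shows "f + g \<in> free_lgroup"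
proof -
  obtain L where L: "continuous_on UNIV f" "finite L" "\<And>l. l \<in> L \<Longrightarrow> integer_linear l"
    "\<And>x. \<exists>l\<in>L. f x = l x"
    using assms(1) by (rule free_lgroupE) blast
  obtain M where M: "continuous_on UNIV g" "finite M" "\<And>l. l \<in> M \<Longrightarrow> integer_linear l"
    "\<And>x. \<exists>l\<in>M. g x = l x"
    using assms(2) by (rule free_lgroupE) blast
  show ?thesis
  proof (rule free_lgroupI[where L = "(\<lambda>(l, m). l + m) ` (L \<times> M)"])
    show "continuous_on UNIV (f + g)"
      using L(1) M(1) unfolding plus_fun_def by (rule continuous_on_add)
    show "\<exists>l\<in>(\<lambda>(l, m). l + m) ` (L \<times> M). (f + g) x = l x" for x
    proof -
      obtain l m where "l \<in> L" "m \<in> M" "f x = l x" "g x = m x" using L(4) M(4) by meson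
      then show ?thesis by (intro bexI[of _ "l + m"]) auto
    qed
  qed (use L(2,3) M(2,3) integer_linear_add in auto)
qed

lemma sup_in_free_lgroup:
  assumes "f \<in> free_lgroup" "g \<in> free_lgroup" shows "sup f g \<in> free_lgroup"
proof -
  obtain L where L: "continuous_on UNIV f" "finite L" "\<And>l. l \<in> L \<Longrightarrow> integer_linear l"
    "\<And>x. \<exists>l\<in>L. f x = l x"
    using assms(1) by (rule free_lgroupE) blast
  obtain M where M: "continuous_on UNIV g" "finite M" "\<And>l. l \<in> M \<Longrightarrow> integer_linear l"
    "\<And>x. \<exists>l\<in>M. g x = l x"
    using assms(2) by (rule free_lgroupE) blast
  show ?thesis
  proof (rule free_lgroupI[where L = "L \<union> M"])
    show "continuous_on UNIV (sup f g)"
      using L(1) M(1) unfolding sup_fun_def sup_max by (rule continuous_on_max)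
    show "\<exists>l\<in>L \<union> M. sup f g x = l x" for x
      using L(4)[of x] M(4)[of x] by (auto simp: sup_max max_def)
  qed (use L(2,3) M(2,3) in auto)
qed

lemma inf_in_free_lgroup:
  assumes "f \<in> free_lgroup" "g \<in> free_lgroup" shows "inf f g \<in> free_lgroup"
proof -
  have "inf f g = - sup (- f) (- g)"
    by (rule ext) (simp add: inf_min sup_max min_def max_def)
  then show ?thesis
    using assms by (simp add: sup_in_free_lgroup uminus_in_free_lgroup)
qed

end

theory Submission
  imports Defs
begin

text \<open>
  The coordinate functions generate \<open>free_lgroup\<close> as an \<open>\<ell>\<close>-group (\<open>free_lgroup_induct\<close>), so an
  endomorphism \<open>\<eta>\<close> is substitution of a continuous map \<open>h\<close> of \<open>\<real>\<^sup>n\<close> into itself, the one with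
  components \<open>\<eta> \<pi>\<^sub>i\<close>: \<open>\<eta> f = f \<circ> h\<close> (\<open>lgroup_hom_eq_substitution\<close>). If \<open>\<eta>\<close> is onto, preimages of
  the coordinate functions are the components of a continuous left inverse of \<open>h\<close>. By invariance of
  domain a continuous self-map of \<open>\<real>\<^sup>n\<close> with a continuous left inverse has open range, and its range
  is closed because it is a retract; hence \<open>h\<close> is surjective (\<open>surj_if_continuous_left_inverse\<close>).
  Now \<open>f \<circ> h = g \<circ> h\<close> forces \<open>f = g\<close>, so \<open>\<eta>\<close> is one-one.

  Generation rests on the max-min form of a continuous piecewise linear function \<open>f\<close> with linear
  pieces \<open>L\<close>. For each point \<open>y\<close> take the minimum of all \<open>l \<in> L\<close> with \<open>f y \<le> l y\<close>. It agrees with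
  \<open>f\<close> at \<open>y\<close>, and the separation property \<open>exists_piece_below_above\<close> says that it lies below \<open>f\<close>
  everywhere. There are only finitely many such minima, and \<open>f\<close> is their maximum.
\<close>

section \<open>Generation by the coordinate functions\<close>

lemma integer_linear_segment:
  assumes "integer_linear l"
  shows "l ((1 - t) *\<^sub>R x + t *\<^sub>R y) = (1 - t) * l x + t * l y"
proof -
  obtain c where c: "\<And>z. l z = (\<Sum>i\<in>UNIV. of_int (c i) * z $ i)"
    using assms unfolding integer_linear_def by blast
  show ?thesis
    unfolding c by (simp add: sum_distrib_left sum.distrib[symmetric] algebra_simps)
qed

text \<open>
  Let \<open>J\<close> be the set of pieces that lie weakly below \<open>f\<close> at \<open>x\<close>. Moving from \<open>x\<close> to \<open>y\<close>, the
  function \<open>f\<close> cannot rise above the upper envelope of \<open>J\<close>: to do so it would have to leave the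
  envelope along a piece outside \<open>J\<close>, but such a piece starts strictly above the envelope and meets
  it only by crossing downwards.
\<close>

lemma exists_piece_below_above:
  fixes f :: "real ^ 'n \<Rightarrow> real"
  assumes cont: "continuous_on UNIV f" and fin: "finite L"
    and lin: "\<And>l. l \<in> L \<Longrightarrow> integer_linear l"
    and piece: "\<And>z. \<exists>l\<in>L. f z = l z"
  shows "\<exists>l\<in>L. l x \<le> f x \<and> f y \<le> l y"
proof (rule ccontr)
  assume none: "\<not> ?thesis"
  define p where "p t = (1 - t) *\<^sub>R x + t *\<^sub>R y" for t :: real
  have p01 [simp]: "p 0 = x" "p 1 = y" by (simp_all add: p_def)
  have contp: "continuous_on S p" for S
    unfolding p_def by (intro continuous_intros)
  have contf: "continuous_on S (\<lambda>t. f (p t))" for S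
    by (rule continuous_on_compose2[OF cont contp]) auto
  have lp: "l (p t) = (1 - t) * l x + t * l y" if "l \<in> L" for l t
    unfolding p_def by (rule integer_linear_segment[OF lin[OF that]])
  have contl: "continuous_on S (\<lambda>t. l (p t))" if "l \<in> L" for l S
    using lp[OF that] by (simp add: continuous_intros)
  define J where "J = {l \<in> L. l x \<le> f x}"
  have finJ: "finite J" using fin by (simp add: J_def)
  \<comment> \<open>\<open>C\<close> consists of the parameters at which \<open>f\<close> lies weakly below the upper envelope of \<open>J\<close>, and
    \<open>s\<close> is the last of them.\<close>
  define C where "C = (\<Union>l\<in>J. {t\<in>{0..1}. f (p t) \<le> l (p t)})"
  have "closed {t\<in>{0..1}. f (p t) \<le> l (p t)}" if "l \<in> J" for l
  proof -
    have "{t\<in>{0..1}. f (p t) \<le> l (p t)} = {0..1} \<inter> {t. f (p t) \<le> l (p t)}" by auto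
    then show ?thesis
      using that by (auto simp: J_def intro!: closed_Int closed_Collect_le contf contl)
  qed
  then have "closed C" unfolding C_def using finJ by blast
  moreover have "C \<subseteq> {0..1}" by (auto simp: C_def)
  ultimately have "compact C"
    by (metis bounded_closed_interval bounded_subset compact_eq_bounded_closed)
  obtain l0 where "l0 \<in> L" "f x = l0 x" using piece[of x] by blast
  then have "0 \<in> C" by (auto simp: C_def J_def)
  then obtain s where s: "s \<in> C" "\<And>t. t \<in> C \<Longrightarrow> t \<le> s"
    using compact_attains_sup[OF \<open>compact C\<close>] by blast
  have "1 \<notin> C" using none by (auto simp: C_def J_def)
  then have "s < 1" "0 \<le> s" using s(1) \<open>C \<subseteq> {0..1}\<close> by (auto simp: less_le)
  obtain i where i: "i \<in> L" "i x \<le> f x" "f (p s) \<le> i (p s)"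
    using s(1) by (auto simp: C_def J_def)
  have above: "l (p t) < f (p t)" if "l \<in> J" "t \<in> {s<..1}" for l t
  proof (rule ccontr)
    assume "\<not> ?thesis"
    then have "t \<in> C" using that \<open>0 \<le> s\<close> unfolding C_def by (intro UN_I[of l]) auto
    then show False using s(2)[of t] that(2) by simp
  qed
  \<comment> \<open>The finitely many pieces cover the interval to the right of \<open>s\<close>, so one of them is active at
    points arbitrarily close to \<open>s\<close>.\<close>
  define D where "D l = {t \<in> {s<..1}. f (p t) = l (p t)}" for l
  have "{s<..1} \<subseteq> (\<Union>l\<in>L. closure (D l))"
  proof
    fix t assume t: "t \<in> {s<..1}"
    obtain l where "l \<in> L" "f (p t) = l (p t)" using piece[of "p t"] by blast
    then have "t \<in> D l" using t by (simp add: D_def)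
    then show "t \<in> (\<Union>l\<in>L. closure (D l))"
      using \<open>l \<in> L\<close> closure_subset[of "D l"] by blast
  qed
  moreover have "closed (\<Union>l\<in>L. closure (D l))" using fin by blast
  ultimately have "closure {s<..1} \<subseteq> (\<Union>l\<in>L. closure (D l))" by (rule closure_minimal)
  moreover have "s \<in> closure {s<..1}" using \<open>s < 1\<close> by simp
  ultimately obtain j where j: "j \<in> L" "s \<in> closure (D j)" by blast
  have "closure (D j) \<subseteq> {t. f (p t) = j (p t)}"
    using j(1) by (intro closure_minimal closed_Collect_eq contf contl) (auto simp: D_def)
  then have js: "f (p s) = j (p s)" using j(2) by auto
  have "D j \<noteq> {}" using j(2) by auto
  then obtain t where t: "s < t" "t \<le> 1" "f (p t) = j (p t)" by (auto simp: D_def)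
  have "j \<notin> J" using above[of j t] t by auto
  then have jx: "i x < j x" using i(2) j(1) by (auto simp: J_def)
  have "j (p s) \<le> i (p s)" using i(3) js by simp
  moreover have "i (p t) < j (p t)" using above[of i t] i t by (auto simp: J_def)
  \<comment> \<open>The affine function \<open>t \<mapsto> j (p t) - i (p t)\<close> is positive at \<open>0\<close> and at \<open>t\<close> but not at \<open>s\<close>.\<close>
  moreover have "(1 - s / t) * (i x - j x) + (s / t) * (i (p t) - j (p t)) = i (p s) - j (p s)"
    using t(1) \<open>0 \<le> s\<close> i(1) j(1) by (simp add: lp field_simps)
  moreover have "(1 - s / t) * (i x - j x) < 0"
    using jx t(1) \<open>0 \<le> s\<close> by (intro mult_pos_neg) auto
  moreover have "(s / t) * (i (p t) - j (p t)) \<le> 0"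
    using \<open>i (p t) < j (p t)\<close> t(1) \<open>0 \<le> s\<close> by (intro mult_nonneg_nonpos) auto
  ultimately show False by linarith
qed

lemma Inf_fin_closed:
  fixes A :: "'a::lattice set"
  assumes "finite A" "A \<noteq> {}" "A \<subseteq> C" "\<And>a b. a \<in> C \<Longrightarrow> b \<in> C \<Longrightarrow> inf a b \<in> C"
  shows "Inf_fin A \<in> C"
  using assms(1-3) by (induction rule: finite_ne_induct) (auto intro: assms(4))

lemma Sup_fin_closed:
  fixes A :: "'a::lattice set"
  assumes "finite A" "A \<noteq> {}" "A \<subseteq> C" "\<And>a b. a \<in> C \<Longrightarrow> b \<in> C \<Longrightarrow> sup a b \<in> C"
  shows "Sup_fin A \<in> C"
  using assms(1-3) by (induction rule: finite_ne_induct) (auto intro: assms(4))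

text \<open>
  The minimum indexed by \<open>y\<close> is at least \<open>f y\<close> at \<open>y\<close> by construction. It is at most \<open>f x\<close> at any
  \<open>x\<close> because \<open>exists_piece_below_above\<close> puts into the minimum a piece that is below \<open>f\<close> at \<open>x\<close>.
\<close>

lemma max_min_representation:
  fixes f :: "real ^ 'n \<Rightarrow> real"
  assumes cont: "continuous_on UNIV f" and fin: "finite L"
    and lin: "\<And>l. l \<in> L \<Longrightarrow> integer_linear l"
    and piece: "\<And>z. \<exists>l\<in>L. f z = l z"
  shows "f = Sup_fin (range (\<lambda>y. Inf_fin {l \<in> L. f y \<le> l y}))"
    and "finite (range (\<lambda>y. Inf_fin {l \<in> L. f y \<le> l y}))"
proof -
  define S where "S y = {l \<in> L. f y \<le> l y}" for y
  define G where "G = range (\<lambda>y. Inf_fin (S y))"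
  have "range S \<subseteq> Pow L" by (auto simp: S_def)
  then have "finite (range S)" using fin by (meson finite_Pow_iff finite_subset)
  then have finG: "finite G" unfolding G_def by (metis finite_imageI image_image)
  have finS: "finite (S y)" for y using fin by (simp add: S_def)
  have neS: "S y \<noteq> {}" for y using piece[of y] by (auto simp: S_def)
  have "g \<le> f" if gG: "g \<in> G" for g
  proof (rule le_funI)
    fix x
    obtain y where y: "g = Inf_fin (S y)" using gG by (auto simp: G_def)
    obtain l where "l \<in> L" "l x \<le> f x" "f y \<le> l y"
      using exists_piece_below_above[OF cont fin lin piece] by blast
    then have "g \<le> l" unfolding y by (intro Inf_fin.coboundedI finS) (simp add: S_def)
    then show "g x \<le> f x" using \<open>l x \<le> f x\<close> by (meson le_funD order_trans)
  qed
  then have "Sup_fin G \<le> f"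
    using finG by (intro Sup_fin.boundedI) (auto simp: G_def)
  moreover have "f y \<le> Sup_fin G y" for y
  proof -
    have "Inf_fin (S y) \<in> {g. f y \<le> g y}"
      by (rule Inf_fin_closed[OF finS neS]) (auto simp: S_def)
    moreover have "Inf_fin (S y) \<le> Sup_fin G"
      using finG by (intro Sup_fin.coboundedI) (auto simp: G_def)
    ultimately show ?thesis by (auto dest: le_funD intro: order_trans)
  qed
  ultimately have "f = Sup_fin G" by (intro antisym le_funI) (auto dest: le_funD)
  then show "f = Sup_fin (range (\<lambda>y. Inf_fin {l \<in> L. f y \<le> l y}))"
    and "finite (range (\<lambda>y. Inf_fin {l \<in> L. f y \<le> l y}))"
    using finG by (simp_all add: G_def S_def)
qed

lemma integer_linear_generated:
  fixes C :: "(real ^ 'n \<Rightarrow> real) set"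
  assumes "integer_linear l" and coord: "\<And>i. (\<lambda>x. x $ i) \<in> C" and zero: "0 \<in> C"
    and uminus: "\<And>f. f \<in> C \<Longrightarrow> - f \<in> C"
    and add: "\<And>f g. f \<in> C \<Longrightarrow> g \<in> C \<Longrightarrow> f + g \<in> C"
  shows "l \<in> C"
proof -
  obtain c where c: "\<And>x. l x = (\<Sum>i\<in>UNIV. of_int (c i) * x $ i)"
    using assms(1) unfolding integer_linear_def by blast
  have nat: "(\<lambda>x. of_nat k * x $ i) \<in> C" for i k
  proof (induction k)
    case 0
    then show ?case using zero by (simp add: zero_fun_def)
  next
    case (Suc k)
    then show ?case using add[OF coord[of i] Suc] by (simp add: plus_fun_def algebra_simps)
  qed
  have int: "(\<lambda>x. of_int k * x $ i) \<in> C" for i k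
  proof (cases k)
    case (nonneg m)
    then show ?thesis using nat[of m i] by simp
  next
    case (neg m)
    show ?thesis
      unfolding neg using uminus[OF nat[of "Suc m" i]] by (simp add: fun_Compl_def algebra_simps)
  qed
  have "(\<lambda>x. \<Sum>i\<in>I. of_int (c i) * x $ i) \<in> C" if "finite I" for I
    using that
  proof (induction I)
    case empty
    then show ?case using zero by (simp add: zero_fun_def)
  next
    case (insert i I)
    then show ?case using add[OF int[of "c i" i] insert.IH] by (simp add: plus_fun_def)
  qed
  then show ?thesis using c by (simp add: ext[of l, OF c])
qed

text \<open>
  This is generation by the coordinate functions in the form of an induction rule: integer linear
  functions are reached by the group operations, and every other element from these by the finite
  minima and maxima of its max-min form.
\<close>

lemma free_lgroup_induct:
  fixes C :: "(real ^ 'n \<Rightarrow> real) set"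
  assumes f: "f \<in> free_lgroup" and coord: "\<And>i. (\<lambda>x. x $ i) \<in> C" and zero: "0 \<in> C"
    and uminus: "\<And>f. f \<in> C \<Longrightarrow> - f \<in> C"
    and add: "\<And>f g. f \<in> C \<Longrightarrow> g \<in> C \<Longrightarrow> f + g \<in> C"
    and sup: "\<And>f g. f \<in> C \<Longrightarrow> g \<in> C \<Longrightarrow> sup f g \<in> C"
    and inf: "\<And>f g. f \<in> C \<Longrightarrow> g \<in> C \<Longrightarrow> inf f g \<in> C"
  shows "f \<in> C"
proof -
  obtain L where L: "continuous_on UNIV f" "finite L" "\<And>l. l \<in> L \<Longrightarrow> integer_linear l"
    "\<And>x. \<exists>l\<in>L. f x = l x"
    using f by (rule free_lgroupE) blast
  have "L \<subseteq> C"
    using integer_linear_generated[OF L(3) coord zero uminus add] by blast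
  have "Inf_fin {l \<in> L. f y \<le> l y} \<in> C" for y
  proof (rule Inf_fin_closed[OF _ _ _ inf])
    show "{l \<in> L. f y \<le> l y} \<noteq> {}" using L(4)[of y] by auto
  qed (use L(2) \<open>L \<subseteq> C\<close> in auto)
  then have "Sup_fin (range (\<lambda>y. Inf_fin {l \<in> L. f y \<le> l y})) \<in> C"
    by (intro Sup_fin_closed[OF max_min_representation(2)[OF L] _ _ sup]) auto
  then show ?thesis using max_min_representation(1)[OF L] by simp
qed

section \<open>Endomorphisms as substitutions\<close>

lemma lgroup_hom_eq_substitution:
  fixes \<eta> :: "(real ^ 'n \<Rightarrow> real) \<Rightarrow> (real ^ 'm \<Rightarrow> real)"
  assumes hom: "lgroup_hom free_lgroup free_lgroup \<eta>" and f: "f \<in> free_lgroup"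
  shows "\<eta> f = (\<lambda>x. f (\<chi> i. \<eta> (\<lambda>z. z $ i) x))"
proof -
  define h where "h x = (\<chi> i. \<eta> (\<lambda>z. z $ i) x)" for x
  note hom' = hom[unfolded lgroup_hom_def]
  have "f \<in> {f \<in> free_lgroup. \<eta> f = (\<lambda>x. f (h x))}"
    using f
  proof (rule free_lgroup_induct)
    show "(\<lambda>x. x $ i) \<in> {f \<in> free_lgroup. \<eta> f = (\<lambda>x. f (h x))}" for i
      by (simp add: coordinate_in_free_lgroup h_def)
    show "0 \<in> {f \<in> free_lgroup. \<eta> f = (\<lambda>x. f (h x))}"
      using hom' zero_in_free_lgroup by (auto simp: zero_fun_def)
  qed (use hom' in \<open>auto simp: uminus_in_free_lgroup add_in_free_lgroup
        sup_in_free_lgroup inf_in_free_lgroup fun_eq_iff\<close>)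
  then show ?thesis by (simp add: h_def)
qed

lemma continuous_on_vec_of_free_lgroup:
  fixes g :: "'i::finite \<Rightarrow> real ^ 'n \<Rightarrow> real"
  assumes "\<And>i. g i \<in> free_lgroup"
  shows "continuous_on UNIV (\<lambda>x. \<chi> i. g i x)"
  using assms by (intro continuous_on_vec_lambda) (auto simp: free_lgroup_def)

section \<open>Continuous maps with a continuous left inverse\<close>

text \<open>
  The range of \<open>h\<close> is open by invariance of domain. It is also the fixed-point set of the continuous
  map \<open>h \<circ> g\<close> and therefore closed, so by connectedness it is the whole space.
\<close>

lemma surj_if_continuous_left_inverse:
  fixes h g :: "'a::euclidean_space \<Rightarrow> 'a"
  assumes h: "continuous_on UNIV h" and g: "continuous_on UNIV g" and inv: "\<And>x. g (h x) = x"
  shows "surj h"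
proof -
  have "inj h" using inv by (metis injI)
  then have "open (range h)" using h by (intro invariance_of_domain) auto
  moreover have "closed (range h)"
  proof -
    have "range h = {y. h (g y) = y}" using inv by (auto intro: range_eqI[OF sym])
    moreover have "closed {y. h (g y) = y}"
      by (intro closed_Collect_eq continuous_on_compose2[OF h g]) auto
    ultimately show ?thesis by simp
  qed
  ultimately show ?thesis using clopen[of "range h"] by auto
qed

section \<open>Surjective endomorphisms are injective\<close>

theorem proposition6p1:
  fixes \<eta> :: "(real ^ 'n \<Rightarrow> real) \<Rightarrow> (real ^ 'n \<Rightarrow> real)"
  assumes "lgroup_hom free_lgroup free_lgroup \<eta>"
    and "\<eta> ` free_lgroup = free_lgroup"
  shows "inj_on \<eta> free_lgroup"
proof -
  define h where "h x = (\<chi> i. \<eta> (\<lambda>z. z $ i) x)" for x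
  have subst: "\<eta> f = (\<lambda>x. f (h x))" if "f \<in> free_lgroup" for f
    unfolding h_def by (rule lgroup_hom_eq_substitution[OF assms(1) that])
  have "\<exists>g\<in>free_lgroup. \<eta> g = (\<lambda>x. x $ i)" for i
    using coordinate_in_free_lgroup assms(2) by (metis imageE)
  then obtain g where g: "\<And>i. g i \<in> free_lgroup" "\<And>i. \<eta> (g i) = (\<lambda>x. x $ i)"
    by metis
  have "surj h"
  proof (rule surj_if_continuous_left_inverse)
    show "continuous_on UNIV h"
      unfolding h_def using assms(2) coordinate_in_free_lgroup
      by (intro continuous_on_vec_of_free_lgroup) blast
    show "continuous_on UNIV (\<lambda>y. \<chi> i. g i y)"
      using g(1) by (rule continuous_on_vec_of_free_lgroup)
    have "g i (h x) = x $ i" for i x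
      using subst[OF g(1)] g(2) by (metis (no_types))
    then show "(\<chi> i. g i (h x)) = x" for x by simp
  qed
  show ?thesis
  proof (rule inj_onI)
    fix f f' assume "f \<in> free_lgroup" "f' \<in> free_lgroup" "\<eta> f = \<eta> f'"
    then have "f (h x) = f' (h x)" for x using subst by metis
    then show "f = f'" using \<open>surj h\<close> by (metis ext surjD)
  qed
qed

end
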